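(* Let $A,Q\in\mathbb{F}^{n\times n}$ with $Q$ Hermitian and nonsingular, and let $\mathbb{X}^{(1)}=(A^{(1)},B^{(1)},Q^{(1)})$ be given by either of the two choices (plus) $A^{(1)}:=f(A)f(Q)^{-1}A$, $B^{(1)}:=f(A)f(Q)^{-1}f(A)^H$, $Q^{(1)}:=Q-A^Hf(Q)^{-1}A$, or (minus) $A^{(1)}:=f(A)f(Q)^{-1}A$, $B^{(1)}:=-f(A)f(Q)^{-1}f(A)^H$, $Q^{(1)}:=Q+A^Hf(Q)^{-1}A$. Suppose that the sequence $\mathbb{X}^{(k)}=(A^{(k)},B^{(k)},Q^{(k)})$, $k\ge1$, defined by $\mathbb{X}^{(k)}=\mathcal{I}_{\mathbb{X}^{(1)}}(\mathbb{X}^{(k-1)},\mathbb{X}^{(1)})$ for $k>1$, has no breakdown (all inverses occurring exist). Assume further that, for all integers $i,j\ge1$, the sequence $\widehat{\mathbb{X}}^{(k)}$ given by $\widehat{\mathbb{X}}^{(1)}=\mathbb{X}^{(i)}$ and $\widehat{\mathbb{X}}^{(k)}=\mathcal{I}_{\mathbb{X}^{(i)}}(\widehat{\mathbb{X}}^{(k-1)},\mathbb{X}^{(j)})$ for $k>1$ is well-defined. Then for all integers $i,j\ge 1$, $\mathbb{X}^{(i+j)}=\widehat{\mathbb{X}}^{(2)}$, namely $$A^{(i+j)}=A^{(j)}(Q^{(j)}-B^{(i)})^{-1}A^{(i)},$$ $$B^{(i+j)}=B^{(j)}+A^{(j)}(Q^{(j)}-B^{(i)})^{-1}(A^{(j)})^H,$$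 $$Q^{(i+j)}=Q^{(i)}-(A^{(i)})^H(Q^{(j)}-B^{(i)})^{-1}A^{(i)}.$$ Furthermore, $\mathbb{X}^{(i+(k-1)j)}=\widehat{\mathbb{X}}^{(k)}$ for every positive integer $k$.
   Context: $\mathbb{F}$ is $\mathbb{R}$ or $\mathbb{C}$; $M^H$ is the conjugate transpose of $M$. The map $f:\mathbb{F}^{n\times n}\to\mathbb{F}^{n\times n}$ satisfies, for all $M,N$: (a1) $f(f(M))=M$; (a2) $f(M+N)=f(M)+f(N)$; (a3) $f(MN)=f(M)f(N)$; (a4) $f(M)$ is positive semidefinite whenever $M$ is. Iteration notation: for triples $\mathbb{X}_1=(A_1,B_1,Q_1)$ and $\mathbb{X}_2=(A_2,B_2,Q_2)$ with $A_i\in\mathbb{F}^{n\times n}$ and $B_i,Q_i$ Hermitian, the notation $\widehat{\mathbb{X}}^{(k)}=\mathcal{I}_{\mathbb{X}_1}(\widehat{\mathbb{X}}^{(k-1)},\mathbb{X}_2)$ means that $\widehat{\mathbb{X}}^{(k)}=(\widehat A^{(k)},\widehat B^{(k)},\widehat Q^{(k)})$ has initial value $\widehat{\mathbb{X}}^{(1)}=\mathbb{X}_1$ and, for $k>1$, $\widehat A^{(k)}=A_2(Q_2-\widehat B^{(k-1)})^{-1}\widehat A^{(k-1)}$, $\widehat B^{(k)}=B_2+A_2(Q_2-\widehat B^{(k-1)})^{-1}A_2^H$, $\widehat Q^{(k)}=\widehat Q^{(k-1)}-(\widehat A^{(k-1)})^H(Q_2-\widehat B^{(k-1)})^{-1}\widehat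 A^{(k-1)}$. It is well-defined if all the inverses exist. *)

theory Defs
  imports "HOL-Analysis.Analysis" "Jordan_Normal_Form.Conjugate"
begin

text \<open>
  The scalar field is the real or the complex field, together with its standard conjugation.
  In the second case below the field is \<open>\<complex>\<close> up to isomorphism: it contains a square root
  \<open>\<iota>\<close> of \<open>-1\<close> and is spanned over the reals by \<open>1\<close> and \<open>\<iota>\<close>.
\<close>

class real_or_complex = real_field + conjugatable_field +
  assumes real_or_complex:
    "(\<forall>z. \<exists>a. z = a *\<^sub>R 1 \<and> conjugate z = a *\<^sub>R 1) \<or>
     (\<exists>\<iota>. \<iota> * \<iota> = -1 \<and>
        (\<forall>z. \<exists>a b. z = a *\<^sub>R 1 + b *\<^sub>R \<iota> \<and>
                conjugate z = a *\<^sub>R 1 - b *\<^sub>R \<iota>))"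

instance real :: real_or_complex
  by intro_classes simp

instance complex :: real_or_complex
proof
  have "\<forall>z::complex. z = Re z *\<^sub>R 1 + Im z *\<^sub>R \<i> \<and> conjugate z = Re z *\<^sub>R 1 - Im z *\<^sub>R \<i>"
    by (simp add: complex_eq_iff)
  then show "(\<forall>z::complex. \<exists>a. z = a *\<^sub>R 1 \<and> conjugate z = a *\<^sub>R 1) \<or>
     (\<exists>\<iota>::complex. \<iota> * \<iota> = -1 \<and>
        (\<forall>z. \<exists>a b. z = a *\<^sub>R 1 + b *\<^sub>R \<iota> \<and>
                conjugate z = a *\<^sub>R 1 - b *\<^sub>R \<iota>))"
    using i_squared by blast
qed

definition conj_transpose :: "'a::real_or_complex^'n^'n \<Rightarrow> 'a^'n^'n"
    (\<open>(_\<^sup>H)\<close> [1000] 999)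
  where "M\<^sup>H = map_matrix conjugate (transpose M)"

definition hermitian :: "'a::real_or_complex^'n^'n \<Rightarrow> bool"
  where "hermitian M \<longleftrightarrow> M\<^sup>H = M"

definition psd :: "'a::real_or_complex^'n^'n \<Rightarrow> bool"
  where "psd M \<longleftrightarrow> hermitian M \<and>
           (\<forall>x. (\<Sum>i\<in>UNIV. conjugate (x $ i) * (M *v x) $ i) \<in> \<real>\<^sub>\<ge>\<^sub>0)"

record ('a, 'n) triple =
  tA :: "'a^'n^'n"
  tB :: "'a^'n^'n"
  tQ :: "'a^'n^'n"

definition iter_step :: "('a::real_or_complex, 'n::finite) triple \<Rightarrow> ('a, 'n) triple \<Rightarrow> ('a, 'n) triple"
  where "iter_step X X2 =
    (let R = matrix_inv (tQ X2 - tB X) in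
     \<lparr>tA = tA X2 ** R ** tA X,
      tB = tB X2 + tA X2 ** R ** (tA X2)\<^sup>H,
      tQ = tQ X - (tA X)\<^sup>H ** R ** tA X\<rparr>)"

text \<open>
  The term of index \<open>k\<close> of the sequence with initial value \<open>X1\<close> at index \<open>1\<close> and
  recursion \<open>iter_step _ X2\<close>; the value at index \<open>0\<close> is a dummy.
\<close>

primrec iteration ::
    "('a::real_or_complex, 'n::finite) triple \<Rightarrow> ('a, 'n) triple \<Rightarrow> nat \<Rightarrow> ('a, 'n) triple"
  where
    "iteration X1 X2 0 = X1"
  | "iteration X1 X2 (Suc k) = (if k = 0 then X1 else iter_step (iteration X1 X2 k) X2)"

text \<open>
  Since \<open>matrix_inv\<close> is total (with an unspecified value on singular matrices), existence of
  the inverses used in the recursion is a separate condition.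
\<close>

definition iteration_well_defined ::
    "('a::real_or_complex, 'n::finite) triple \<Rightarrow> ('a, 'n) triple \<Rightarrow> bool"
  where "iteration_well_defined X1 X2 \<longleftrightarrow>
           (\<forall>k>1. invertible (tQ X2 - tB (iteration X1 X2 (k - 1))))"

end

theory Submission
  imports Defs
begin

text \<open>
  Write \<open>X \<star> Y\<close> for \<open>iter_step X Y\<close>. The claim \<open>X\<^sub>i\<^sub>+\<^sub>j = X\<^sub>i \<star> X\<^sub>j\<close> is the law of exponents for the
  powers \<open>X\<^sub>k\<^sub>+\<^sub>1 = X\<^sub>k \<star> X\<^sub>1\<close>, and it holds because \<open>\<star>\<close> is associative
  (\<open>iter_step_assoc\<close>): it is a form of the Redheffer star product, which glues two linear systems
  by eliminating the variable that they share, and eliminating two such variables gives the same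
  result in either order. In formulas, for operands \<open>(A\<^sub>i, B\<^sub>i, Q\<^sub>i)\<close>, \<open>i = 1, 2, 3\<close>, put
  \<open>S = Q\<^sub>2 - B\<^sub>1\<close> and \<open>T = Q\<^sub>3 - B\<^sub>2\<close>. One bracketing inverts \<open>S\<close> and then the Schur complement
  \<open>T - A\<^sub>2 S\<^sup>-\<^sup>1 A\<^sub>2\<^sup>H\<close>, the other inverts \<open>T\<close> and then the Schur complement \<open>S - A\<^sub>2\<^sup>H T\<^sup>-\<^sup>1 A\<^sub>2\<close>; the
  identities of \<open>Schur_complement_inverses\<close> relate the two.

  A general star product has four components per operand; a triple omits one of them, which
  is understood to be \<open>A\<^sup>H\<close>. The recursion respects this convention when the inverses that occur are
  Hermitian, hence when all the \<open>B\<close> and \<open>Q\<close> are. The step preserves this property, so it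
  remains to check it for \<open>X\<^sub>1\<close>, where it follows once \<open>f Q\<close> is Hermitian and invertible. Now \<open>f\<close>
  preserves Hermitian matrices because it is additive and preserves positive semidefinite ones, and
  \<open>4 M = (M + 1)\<^sup>2 - (M - 1)\<^sup>2\<close> is a difference of two positive semidefinite matrices when \<open>M\<close> is
  Hermitian.
\<close>

section \<open>Matrix algebra and the conjugate transpose\<close>

lemma matrix_mult_left_diff_distrib:
  fixes A B :: "'a::ring_1^'n::finite^'m" and C :: "'a^'p^'n"
  shows "(A - B) ** C = A ** C - B ** C"
  by (simp add: vec_eq_iff matrix_matrix_mult_def left_diff_distrib sum_subtractf)

lemma matrix_mult_right_diff_distrib:
  fixes A :: "'a::ring_1^'n::finite^'m" and B C :: "'a^'p^'n"
  shows "A ** (B - C) = A ** B - A ** C"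
  by (simp add: vec_eq_iff matrix_matrix_mult_def right_diff_distrib sum_subtractf)

lemma matrix_mult_left_add_distrib:
  fixes A B :: "'a::ring_1^'n::finite^'m" and C :: "'a^'p^'n"
  shows "(A + B) ** C = A ** C + B ** C"
  by (simp add: vec_eq_iff matrix_matrix_mult_def distrib_right sum.distrib)

lemmas matrix_distribs =
  matrix_mult_left_diff_distrib matrix_mult_right_diff_distrib
  matrix_mult_left_add_distrib matrix_add_ldistrib

lemma matrix_inv_mult:
  fixes M :: "'a::semiring_1^'n^'n::finite"
  assumes "invertible M"
  shows "M ** matrix_inv M = mat 1" "matrix_inv M ** M = mat 1"
  using someI_ex[OF assms[unfolded invertible_def]] by (simp_all add: matrix_inv_def)

lemma conjugate_one: "conjugate (1 :: 'a::conjugatable_field) = 1"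
proof -
  have "conjugate (1 * conjugate (1 :: 'a)) = conjugate 1 * 1"
    by (simp only: conjugate_dist_mul conjugate_id)
  then show ?thesis by simp
qed

lemma conj_transpose_nth: "M\<^sup>H $ i $ j = conjugate (M $ j $ i)"
  by (simp add: conj_transpose_def transpose_def)

lemma conj_transpose_conj_transpose [simp]: "(M\<^sup>H)\<^sup>H = M"
  by (simp add: vec_eq_iff conj_transpose_nth)

lemma conj_transpose_add: "(M + N)\<^sup>H = M\<^sup>H + N\<^sup>H"
  by (simp add: vec_eq_iff conj_transpose_nth conjugate_dist_add)

lemma conj_transpose_minus: "(- M)\<^sup>H = - M\<^sup>H"
  by (simp add: vec_eq_iff conj_transpose_nth conjugate_neg)

lemma conj_transpose_diff: "(M - N)\<^sup>H = M\<^sup>H - N\<^sup>H"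
  using conj_transpose_add[of M "- N"] by (simp add: conj_transpose_minus)

lemma conj_transpose_mult: "(M ** N)\<^sup>H = N\<^sup>H ** M\<^sup>H"
  for M N :: "'a::real_or_complex^'n::finite^'n"
  by (simp add: vec_eq_iff conj_transpose_nth matrix_matrix_mult_def sum_conjugate
      conjugate_dist_mul mult.commute)

lemma conj_transpose_one: "(mat 1)\<^sup>H = (mat 1 :: 'a::real_or_complex^'n::finite^'n)"
  by (simp add: vec_eq_iff conj_transpose_nth mat_def conjugate_one)

section \<open>Hermitian and positive semidefinite matrices\<close>

lemma hermitian_one: "hermitian (mat 1 :: 'a::real_or_complex^'n::finite^'n)"
  by (simp add: hermitian_def conj_transpose_one)

lemma hermitian_add: "hermitian M \<Longrightarrow> hermitian N \<Longrightarrow> hermitian (M + N)"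
  by (simp add: hermitian_def conj_transpose_add)

lemma hermitian_minus: "hermitian M \<Longrightarrow> hermitian (- M)"
  by (simp add: hermitian_def conj_transpose_minus)

lemma hermitian_diff: "hermitian M \<Longrightarrow> hermitian N \<Longrightarrow> hermitian (M - N)"
  by (simp add: hermitian_def conj_transpose_diff)

lemma hermitian_congruence:
  fixes M R :: "'a::real_or_complex^'n::finite^'n"
  assumes "hermitian R"
  shows "hermitian (M ** R ** M\<^sup>H)" "hermitian (M\<^sup>H ** R ** M)"
  using assms by (simp_all add: hermitian_def conj_transpose_mult matrix_mul_assoc)

lemma hermitian_matrix_inv:
  fixes M :: "'a::real_or_complex^'n::finite^'n"
  assumes "hermitian M" "invertible M"
  shows "hermitian (matrix_inv M)"
proof -
  have "(matrix_inv M)\<^sup>H ** M = mat 1"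
    using matrix_inv_mult(1)[OF assms(2)] assms(1)
    by (metis conj_transpose_mult conj_transpose_one hermitian_def)
  then have "(matrix_inv M)\<^sup>H = matrix_inv M"
    by (metis assms(2) matrix_inv_mult(1) matrix_mul_assoc matrix_mul_lid matrix_mul_rid)
  then show ?thesis by (simp add: hermitian_def)
qed

lemma hermitian_half:
  fixes M :: "'a::real_or_complex^'n^'n"
  assumes "hermitian (M + M)"
  shows "hermitian M"
proof -
  have "M\<^sup>H + M\<^sup>H = M + M"
    using assms by (simp only: hermitian_def conj_transpose_add)
  then have "M\<^sup>H $ i $ j + M\<^sup>H $ i $ j = M $ i $ j + M $ i $ j" for i j
    by (metis vector_add_component)
  then have "2 * M\<^sup>H $ i $ j = 2 * M $ i $ j" for i j
    by (simp only: mult_2)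
  then show ?thesis by (simp add: hermitian_def vec_eq_iff)
qed

lemma conjugate_mult_self_nonneg:
  fixes z :: "'a::real_or_complex"
  shows "conjugate z * z \<in> \<real>\<^sub>\<ge>\<^sub>0"
  using real_or_complex
proof
  assume "\<forall>z::'a. \<exists>a. z = a *\<^sub>R 1 \<and> conjugate z = a *\<^sub>R 1"
  then obtain a where "z = a *\<^sub>R 1" "conjugate z = a *\<^sub>R 1" by blast
  then have "conjugate z * z = of_real (a * a)" by (simp add: of_real_def)
  then show ?thesis by (metis nonneg_Reals_of_real_iff zero_le_square)
next
  assume "\<exists>\<iota>::'a. \<iota> * \<iota> = -1 \<and>
    (\<forall>z. \<exists>a b. z = a *\<^sub>R 1 + b *\<^sub>R \<iota> \<and> conjugate z = a *\<^sub>R 1 - b *\<^sub>R \<iota>)"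
  then obtain i a b where i: "i * i = (-1::'a)" and
    z: "z = a *\<^sub>R 1 + b *\<^sub>R i" "conjugate z = a *\<^sub>R 1 - b *\<^sub>R i" by blast
  have "conjugate z * z = (a *\<^sub>R 1 - b *\<^sub>R i) * (a *\<^sub>R 1 + b *\<^sub>R i)"
    unfolding z(2) by (simp only: z(1)[symmetric])
  also have "\<dots> = of_real (a * a + b * b)"
    by (simp add: of_real_def algebra_simps i)
  finally have "conjugate z * z = of_real (a * a + b * b)" .
  then show ?thesis
    by (metis nonneg_Reals_of_real_iff add_nonneg_nonneg zero_le_square)
qed

lemma sum_nonneg_Reals:
  fixes g :: "'b \<Rightarrow> 'a::real_algebra_1"
  assumes "\<And>i. i \<in> I \<Longrightarrow> g i \<in> \<real>\<^sub>\<ge>\<^sub>0"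
  shows "sum g I \<in> \<real>\<^sub>\<ge>\<^sub>0"
  using assms by (induction I rule: infinite_finite_induct) auto

lemma psd_conj_transpose_mult_self:
  fixes M :: "'a::real_or_complex^'n::finite^'n"
  shows "psd (M\<^sup>H ** M)"
  unfolding psd_def
proof (intro conjI allI)
  show "hermitian (M\<^sup>H ** M)"
    by (simp add: hermitian_def conj_transpose_mult)
  fix x :: "'a^'n"
  let ?y = "M *v x"
  have conj_y: "conjugate (?y $ k) = (\<Sum>i\<in>UNIV. conjugate (x $ i) * conjugate (M $ k $ i))" for k
    by (simp add: matrix_vector_mult_def sum_conjugate conjugate_dist_mul mult.commute)
  have "(\<Sum>i\<in>UNIV. conjugate (x $ i) * ((M\<^sup>H ** M) *v x) $ i)
      = (\<Sum>i\<in>UNIV. \<Sum>k\<in>UNIV. conjugate (x $ i) * (conjugate (M $ k $ i) * ?y $ k))"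
    unfolding matrix_vector_mul_assoc[symmetric]
    by (subst matrix_vector_mult_def) (simp add: conj_transpose_nth sum_distrib_left)
  also have "\<dots> = (\<Sum>k\<in>UNIV. \<Sum>i\<in>UNIV. conjugate (x $ i) * (conjugate (M $ k $ i) * ?y $ k))"
    by (rule sum.swap)
  also have "\<dots> = (\<Sum>k\<in>UNIV. conjugate (?y $ k) * ?y $ k)"
    by (simp only: conj_y sum_distrib_right mult.assoc)
  also have "\<dots> \<in> \<real>\<^sub>\<ge>\<^sub>0"
    by (intro sum_nonneg_Reals conjugate_mult_self_nonneg)
  finally show "(\<Sum>i\<in>UNIV. conjugate (x $ i) * ((M\<^sup>H ** M) *v x) $ i) \<in> \<real>\<^sub>\<ge>\<^sub>0" .
qed

text \<open>
  Polarization: \<open>(M + 1)\<^sup>2\<close> and \<open>(M - 1)\<^sup>2\<close> are positive semidefinite, and applying \<open>f\<close> to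
  \<open>(M + 1)\<^sup>2 = 4 M + (M - 1)\<^sup>2\<close> exhibits \<open>4 f M\<close> as a difference of Hermitian matrices. Additivity
  of \<open>f\<close> suffices because the only scalars involved are integers.
\<close>

lemma additive_psd_preserving_imp_hermitian:
  fixes f :: "'a::real_or_complex^'n::finite^'n \<Rightarrow> 'a^'n^'n"
  assumes add: "\<And>M N. f (M + N) = f M + f N"
    and psd: "\<And>M. psd M \<Longrightarrow> psd (f M)"
    and M: "hermitian M"
  shows "hermitian (f M)"
proof -
  let ?K = "M + mat 1" and ?L = "M - mat 1"
  have "hermitian ?K" "hermitian ?L"
    by (simp_all add: M hermitian_one hermitian_add hermitian_diff)
  then have "psd (?K ** ?K)" "psd (?L ** ?L)"
    using psd_conj_transpose_mult_self[of ?K] psd_conj_transpose_mult_self[of ?L]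
    by (simp_all add: hermitian_def)
  then have herm: "hermitian (f (?K ** ?K))" "hermitian (f (?L ** ?L))"
    using psd psd_def by blast+
  have "?K ** ?K = ((M + M) + (M + M)) + ?L ** ?L"
    by (simp add: matrix_distribs algebra_simps)
  then have "f (?K ** ?K) = ((f M + f M) + (f M + f M)) + f (?L ** ?L)"
    by (simp only: add)
  then have "(f M + f M) + (f M + f M) = f (?K ** ?K) - f (?L ** ?L)"
    by simp
  then show ?thesis
    by (metis herm hermitian_diff hermitian_half)
qed

text \<open>An involution is surjective, so \<open>f 1\<close> is neutral for all matrices and hence equals \<open>1\<close>.\<close>

lemma multiplicative_involution_invertible:
  fixes f :: "'a::real_or_complex^'n::finite^'n \<Rightarrow> 'a^'n^'n"
  assumes inv: "\<And>M. f (f M) = M"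
    and mult: "\<And>M N. f (M ** N) = f M ** f N"
    and M: "invertible M"
  shows "invertible (f M)"
proof -
  have one: "f (mat 1) = mat 1"
    by (metis inv mult matrix_mul_lid matrix_mul_rid)
  have "f M ** f (matrix_inv M) = mat 1" "f (matrix_inv M) ** f M = mat 1"
    by (simp_all add: mult[symmetric] matrix_inv_mult[OF M] one)
  then show ?thesis by (auto simp: invertible_def)
qed

section \<open>Associativity of the iteration step\<close>

text \<open>
  \<open>V\<close> and \<open>W\<close> are the inverses of the Schur complements of \<open>S\<close> and of \<open>T\<close> in the block matrix
  \<open>(S, C; E, T)\<close>, where \<open>R = S\<^sup>-\<^sup>1\<close> and \<open>U = T\<^sup>-\<^sup>1\<close>. The first identity equates the two expressions
  for an off-diagonal block of the inverse of that matrix (up to sign), the other two are the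
  Woodbury formulas for its diagonal blocks.
\<close>

lemma Schur_complement_inverses:
  fixes R S T U V W C E :: "'a::ring_1^'n::finite^'n"
  assumes R: "R ** S = mat 1"
    and U: "U ** T = mat 1" "T ** U = mat 1"
    and V: "V ** (T - E ** R ** C) = mat 1"
    and W: "(S - C ** U ** E) ** W = mat 1"
  shows "V ** E ** R = U ** E ** W"
    and "V = U + U ** E ** W ** C ** U"
    and "W = R + R ** C ** V ** E ** R"
proof -
  have "(T - E ** R ** C) ** U ** E = E - E ** R ** C ** U ** E"
    by (simp add: matrix_distribs U(2))
  also have "\<dots> = E ** R ** (S - C ** U ** E)"
    using R by (simp add: matrix_distribs matrix_mul_assoc[symmetric])
  finally have interchange: "(T - E ** R ** C) ** U ** E = E ** R ** (S - C ** U ** E)" .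
  have "U ** E ** W = V ** (T - E ** R ** C) ** (U ** E ** W)"
    by (simp only: V matrix_mul_lid)
  also have "\<dots> = V ** ((T - E ** R ** C) ** U ** E) ** W"
    by (simp only: matrix_mul_assoc)
  also have "\<dots> = V ** E ** R ** ((S - C ** U ** E) ** W)"
    unfolding interchange by (simp only: matrix_mul_assoc)
  also have "\<dots> = V ** E ** R"
    by (simp only: W matrix_mul_rid)
  finally show off_diagonal: "V ** E ** R = U ** E ** W" ..
  have "U = V ** (T - E ** R ** C) ** U"
    by (simp add: V)
  also have "\<dots> = V - V ** E ** R ** C ** U"
    using U(2) by (simp add: matrix_distribs matrix_mul_assoc[symmetric])
  finally show "V = U + U ** E ** W ** C ** U"
    by (simp add: off_diagonal algebra_simps)
  have "R = R ** ((S - C ** U ** E) ** W)"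
    by (simp add: W)
  also have "\<dots> = W - R ** C ** (U ** E ** W)"
    using R by (simp add: matrix_distribs matrix_mul_assoc)
  finally show "W = R + R ** C ** V ** E ** R"
    by (simp add: off_diagonal[symmetric] matrix_mul_assoc algebra_simps)
qed

lemma iter_step_simps:
  "tA (iter_step X Y) = tA Y ** matrix_inv (tQ Y - tB X) ** tA X"
  "tB (iter_step X Y) = tB Y + tA Y ** matrix_inv (tQ Y - tB X) ** (tA Y)\<^sup>H"
  "tQ (iter_step X Y) = tQ X - (tA X)\<^sup>H ** matrix_inv (tQ Y - tB X) ** tA X"
  by (simp_all add: iter_step_def Let_def)

lemma iter_step_assoc:
  fixes X Y Z :: "('a::real_or_complex, 'n::finite) triple"
  assumes herm: "hermitian (tB X)" "hermitian (tQ Y)" "hermitian (tB Y)" "hermitian (tQ Z)"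
    and inv: "invertible (tQ Y - tB X)" "invertible (tQ Z - tB Y)"
      "invertible (tQ Z - tB (iter_step X Y))" "invertible (tQ (iter_step Y Z) - tB X)"
  shows "iter_step (iter_step X Y) Z = iter_step X (iter_step Y Z)"
proof -
  define S T where "S = tQ Y - tB X" and "T = tQ Z - tB Y"
  define R U where "R = matrix_inv S" and "U = matrix_inv T"
  define V W where "V = matrix_inv (tQ Z - tB (iter_step X Y))"
    and "W = matrix_inv (tQ (iter_step Y Z) - tB X)"
  define E where "E = tA Y"
  have hermRU: "R\<^sup>H = R" "U\<^sup>H = U"
    using hermitian_matrix_inv[OF hermitian_diff inv(1)] hermitian_matrix_inv[OF hermitian_diff inv(2)]
      herm by (simp_all add: hermitian_def R_def S_def U_def T_def)
  have "tQ Z - tB (iter_step X Y) = T - E ** R ** E\<^sup>H"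
    by (simp add: iter_step_simps T_def R_def S_def E_def)
  then have V: "V ** (T - E ** R ** E\<^sup>H) = mat 1"
    using matrix_inv_mult(2)[OF inv(3)] by (simp add: V_def)
  have "tQ (iter_step Y Z) - tB X = S - E\<^sup>H ** U ** E"
    by (simp add: iter_step_simps T_def U_def S_def E_def)
  then have W: "(S - E\<^sup>H ** U ** E) ** W = mat 1"
    using matrix_inv_mult(1)[OF inv(4)] by (simp add: W_def)
  have "R ** S = mat 1" "U ** T = mat 1" "T ** U = mat 1"
    using matrix_inv_mult inv(1,2) by (simp_all add: R_def S_def U_def T_def)
  note eqs = Schur_complement_inverses[OF this V W]
  have lhs: "iter_step (iter_step X Y) Z =
      \<lparr>tA = tA Z ** (V ** E ** R) ** tA X,
       tB = tB Z + tA Z ** V ** (tA Z)\<^sup>H,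
       tQ = tQ X - (tA X)\<^sup>H ** (R + R ** E\<^sup>H ** V ** E ** R) ** tA X\<rparr>"
    unfolding iter_step_def[of "iter_step X Y" Z] Let_def V_def[symmetric]
    by (simp add: iter_step_simps S_def[symmetric] R_def[symmetric] E_def[symmetric]
        conj_transpose_mult hermRU matrix_distribs matrix_mul_assoc)
  have rhs: "iter_step X (iter_step Y Z) =
      \<lparr>tA = tA Z ** (U ** E ** W) ** tA X,
       tB = tB Z + tA Z ** (U + U ** E ** W ** E\<^sup>H ** U) ** (tA Z)\<^sup>H,
       tQ = tQ X - (tA X)\<^sup>H ** W ** tA X\<rparr>"
    unfolding iter_step_def[of X "iter_step Y Z"] Let_def W_def[symmetric]
    by (simp add: iter_step_simps T_def[symmetric] U_def[symmetric] E_def[symmetric]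
        conj_transpose_mult hermRU matrix_distribs matrix_mul_assoc)
  show ?thesis
    unfolding lhs rhs by (simp only: eqs(1) eqs(2,3)[symmetric])
qed

section \<open>The law of exponents\<close>

lemma iter_step_hermitian:
  fixes X Y :: "('a::real_or_complex, 'n::finite) triple"
  assumes "hermitian (tB X)" "hermitian (tQ X)" "hermitian (tB Y)" "hermitian (tQ Y)"
    and "invertible (tQ Y - tB X)"
  shows "hermitian (tB (iter_step X Y))" "hermitian (tQ (iter_step X Y))"
  using assms
  by (simp_all add: iter_step_simps hermitian_add hermitian_diff hermitian_matrix_inv
      hermitian_congruence)

lemma iteration_Suc: "k \<ge> 1 \<Longrightarrow> iteration X Y (Suc k) = iter_step (iteration X Y k) Y"
  by simp

lemma iteration_two: "iteration X Y 2 = iter_step X Y"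
  by (simp add: numeral_2_eq_2)

lemma iteration_well_definedD:
  assumes "iteration_well_defined X Y" "k \<ge> 1"
  shows "invertible (tQ Y - tB (iteration X Y k))"
  using assms(1)[unfolded iteration_well_defined_def, rule_format, of "Suc k"] assms(2) by simp

lemma iteration_hermitian:
  fixes X Y :: "('a::real_or_complex, 'n::finite) triple"
  assumes "hermitian (tB X)" "hermitian (tQ X)" "hermitian (tB Y)" "hermitian (tQ Y)"
    and "iteration_well_defined X Y" and "k \<ge> 1"
  shows "hermitian (tB (iteration X Y k))" "hermitian (tQ (iteration X Y k))"
proof -
  have "hermitian (tB (iteration X Y k)) \<and> hermitian (tQ (iteration X Y k))"
    using \<open>k \<ge> 1\<close>
  proof (induction k rule: dec_induct)
    case base
    then show ?case using assms by simp
  next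
    case (step k)
    then show ?case
      using assms iter_step_hermitian iteration_well_definedD iteration_Suc by metis
  qed
  then show "hermitian (tB (iteration X Y k))" "hermitian (tQ (iteration X Y k))" by auto
qed

text \<open>
  Induction on \<open>j\<close>: \<open>X\<^sub>i\<^sub>+\<^sub>j\<^sub>+\<^sub>1 = (X\<^sub>i \<star> X\<^sub>j) \<star> X\<^sub>1 = X\<^sub>i \<star> (X\<^sub>j \<star> X\<^sub>1) = X\<^sub>i \<star> X\<^sub>j\<^sub>+\<^sub>1\<close>. The four inverses
  required for associativity are those of \<open>Q\<^sub>n - B\<^sub>m\<close> for \<open>(m, n)\<close> equal to \<open>(i, j)\<close>, \<open>(j, 1)\<close>,
  \<open>(i + j, 1)\<close> and \<open>(i, j + 1)\<close>.
\<close>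

lemma iteration_add:
  fixes X1 :: "('a::real_or_complex, 'n::finite) triple"
  defines "X \<equiv> iteration X1 X1"
  assumes herm: "\<And>k. k \<ge> 1 \<Longrightarrow> hermitian (tB (X k))" "\<And>k. k \<ge> 1 \<Longrightarrow> hermitian (tQ (X k))"
    and inv: "\<And>i j. i \<ge> 1 \<Longrightarrow> j \<ge> 1 \<Longrightarrow> invertible (tQ (X j) - tB (X i))"
    and i: "i \<ge> 1" and j: "j \<ge> 1"
  shows "X (i + j) = iter_step (X i) (X j)"
  using j
proof (induction j rule: dec_induct)
  case base
  then show ?case using i by (simp add: X_def)
next
  case (step j)
  have one: "X 1 = X1" and Suc: "X (Suc k) = iter_step (X k) (X 1)" if "k \<ge> 1" for k
    using that by (simp_all add: X_def)
  have "X (i + Suc j) = iter_step (iter_step (X i) (X j)) (X 1)"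
    using Suc[of "i + j"] step i by simp
  also have "\<dots> = iter_step (X i) (iter_step (X j) (X 1))"
  proof (rule iter_step_assoc)
    show "invertible (tQ (X 1) - tB (iter_step (X i) (X j)))"
      using inv[of "i + j" 1] step i by simp
    show "invertible (tQ (iter_step (X j) (X 1)) - tB (X i))"
      using inv[of i "Suc j"] Suc[of j] step i by simp
  qed (use herm inv i step in auto)
  also have "\<dots> = iter_step (X i) (X (Suc j))"
    using Suc[of j] step by simp
  finally show ?case .
qed

theorem proposition2p1:
  fixes f :: "'a::real_or_complex^'n^'n \<Rightarrow> 'a^'n^'n"
    and A Q :: "'a^'n^'n"
    and X1 :: "('a, 'n) triple"
    and X :: "nat \<Rightarrow> ('a, 'n) triple"
  assumes a1: "\<And>M. f (f M) = M"
    and a2: "\<And>M N. f (M + N) = f M + f N"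
    and a3: "\<And>M N. f (M ** N) = f M ** f N"
    and a4: "\<And>M. psd M \<Longrightarrow> psd (f M)"
    and Q: "hermitian Q" "invertible Q"
    and X1:
      "X1 = \<lparr>tA = f A ** matrix_inv (f Q) ** A,
             tB = f A ** matrix_inv (f Q) ** (f A)\<^sup>H,
             tQ = Q - A\<^sup>H ** matrix_inv (f Q) ** A\<rparr> \<or>
       X1 = \<lparr>tA = f A ** matrix_inv (f Q) ** A,
             tB = - (f A ** matrix_inv (f Q) ** (f A)\<^sup>H),
             tQ = Q + A\<^sup>H ** matrix_inv (f Q) ** A\<rparr>"
    and X: "X = iteration X1 X1"
    and no_breakdown: "iteration_well_defined X1 X1"
    and well_defined:
      "\<And>i j. i \<ge> 1 \<Longrightarrow> j \<ge> 1 \<Longrightarrow> iteration_well_defined (X i) (X j)"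
  shows
    "(\<forall>i\<ge>1. \<forall>j\<ge>1.
        X (i + j) = iteration (X i) (X j) 2 \<and>
        tA (X (i + j)) = tA (X j) ** matrix_inv (tQ (X j) - tB (X i)) ** tA (X i) \<and>
        tB (X (i + j)) =
          tB (X j) + tA (X j) ** matrix_inv (tQ (X j) - tB (X i)) ** (tA (X j))\<^sup>H \<and>
        tQ (X (i + j)) =
          tQ (X i) - (tA (X i))\<^sup>H ** matrix_inv (tQ (X j) - tB (X i)) ** tA (X i)) \<and>
     (\<forall>i\<ge>1. \<forall>j\<ge>1. \<forall>k\<ge>1. X (i + (k - 1) * j) = iteration (X i) (X j) k)"
proof -
  have fQ: "hermitian (f Q)" "invertible (f Q)"
    using additive_psd_preserving_imp_hermitian[of f Q, OF a2 a4 Q(1)]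
      multiplicative_involution_invertible[of f Q, OF a1 a3 Q(2)] by auto
  have "hermitian (tB X1)" "hermitian (tQ X1)"
    using X1 Q(1) hermitian_congruence[OF hermitian_matrix_inv[OF fQ]]
    by (auto simp: hermitian_add hermitian_diff hermitian_minus)
  then have herm: "hermitian (tB (X k))" "hermitian (tQ (X k))" if "k \<ge> 1" for k
    using iteration_hermitian no_breakdown that unfolding X by blast+
  have inv: "invertible (tQ (X j) - tB (X i))" if "i \<ge> 1" "j \<ge> 1" for i j
    using iteration_well_definedD[OF well_defined[OF that], of 1] by simp
  have add: "X (i + j) = iter_step (X i) (X j)" if "i \<ge> 1" "j \<ge> 1" for i j
    using iteration_add[of X1 i j] herm inv that unfolding X by blast
  have "X (i + (k - 1) * j) = iteration (X i) (X j) k"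
    if ij: "i \<ge> 1" "j \<ge> 1" and "k \<ge> 1" for i j k
    using \<open>k \<ge> 1\<close>
  proof (induction k rule: dec_induct)
    case base
    then show ?case by simp
  next
    case (step k)
    have "X (i + (Suc k - 1) * j) = X ((i + (k - 1) * j) + j)"
      using step by (cases k) (simp_all add: add_ac)
    also have "\<dots> = iter_step (X (i + (k - 1) * j)) (X j)"
      using add ij by simp
    also have "\<dots> = iteration (X i) (X j) (Suc k)"
      using step iteration_Suc by simp
    finally show ?case .
  qed
  then show ?thesis
    using add by (simp add: iteration_two iter_step_simps)
qed

end
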